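(* Let $G$ be a finite simple graph with no isolated vertices such that $G \neq \widetilde G$, let $T$ be a minimum twin cover of $G$, and let $t\in\mathbb{N}$. Then \[ (t+1)|T| \le \det(\mu^{(t)}(G)) \le (t+1)|T| + \det(\widetilde G), \] and both bounds are sharp (each is attained with equality for some such graph $G$).
   Context: For $t \in \mathbb{N}$ and a graph $G$ with $V(G)=\{v_1,\dots,v_n\}$, the generalized Mycielskian $\mu^{(t)}(G)$ has vertex set $\{u_i^s : 1\le i\le n,\ 0\le s\le t\} \cup \{w\}$, with $u_i^0$ identified with $v_i$. For each edge $v_iv_j$ of $G$ it has edges $u_i^0u_j^0$ and $u_i^su_j^{s+1}$, $u_j^su_i^{s+1}$ for $0 \le s < t$; also edges $u_i^t w$ for $1 \le i \le n$; no other edges. Two vertices are twins if they have the same open neighborhood. Define $x\sim y$ if $x=y$ or $x,y$ are twins; the quotient graph $\widetilde G$ has the classes $[x]$ as vertices, with $[x]$ adjacent to $[z]$ iff $x$ is adjacent to $z$ in $G$ ($G=\widetilde G$ exactly when $G$ is twin-free). A minimum twin cover of $G$ is a minimum size subset of $V(G)$ containing at least one vertex from every pair of twins. A determining set is a vertex set such that only the identity automorphism fixes each of its vertices; $\det$ denotes the minimum size of one. *)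

theory Defs
  imports Main "Graph_Theory.Pair_Digraph"
begin

text \<open>
  Finite simple graphs are the \<open>pair_graph\<close>s of the AFP: finite, loop-free, symmetric digraphs
  without parallel arcs, an edge being the pair of arcs in both directions.
\<close>

definition open_nbhd :: "'a pair_pre_digraph \<Rightarrow> 'a \<Rightarrow> 'a set" where
  "open_nbhd G v = {u. (v, u) \<in> parcs G}"

definition no_isolated_vertices :: "'a pair_pre_digraph \<Rightarrow> bool" where
  "no_isolated_vertices G \<longleftrightarrow> (\<forall>v \<in> pverts G. open_nbhd G v \<noteq> {})"

definition twins :: "'a pair_pre_digraph \<Rightarrow> 'a \<Rightarrow> 'a \<Rightarrow> bool" where
  "twins G x y \<longleftrightarrow>
    x \<in> pverts G \<and> y \<in> pverts G \<and> x \<noteq> y \<and> open_nbhd G x = open_nbhd G y"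

definition twin_cover :: "'a pair_pre_digraph \<Rightarrow> 'a set \<Rightarrow> bool" where
  "twin_cover G T \<longleftrightarrow> T \<subseteq> pverts G \<and> (\<forall>x y. twins G x y \<longrightarrow> x \<in> T \<or> y \<in> T)"

definition minimum_twin_cover :: "'a pair_pre_digraph \<Rightarrow> 'a set \<Rightarrow> bool" where
  "minimum_twin_cover G T \<longleftrightarrow> is_arg_min card (twin_cover G) T"

definition twin_rel :: "'a pair_pre_digraph \<Rightarrow> 'a rel" where
  "twin_rel G = {(x, y). x \<in> pverts G \<and> y \<in> pverts G \<and> (x = y \<or> twins G x y)}"

definition twin_quotient :: "'a pair_pre_digraph \<Rightarrow> 'a set pair_pre_digraph" where
  "twin_quotient G =
    \<lparr> pverts = pverts G // twin_rel G,
      parcs = {(twin_rel G `` {x}, twin_rel G `` {z}) | x z. (x, z) \<in> parcs G} \<rparr>"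

text \<open>
  A graph and its twin quotient have different vertex types; they are compared after
  identifying a vertex \<open>x\<close> with the singleton \<open>{x}\<close>.
\<close>

definition equals_twin_quotient :: "'a pair_pre_digraph \<Rightarrow> bool" where
  "equals_twin_quotient G \<longleftrightarrow>
    twin_quotient G =
      \<lparr> pverts = (\<lambda>x. {x}) ` pverts G, parcs = (\<lambda>(x, y). ({x}, {y})) ` parcs G \<rparr>"

text \<open>
  An automorphism is only considered up to its values on the vertex set.
\<close>

definition automorphism :: "'a pair_pre_digraph \<Rightarrow> ('a \<Rightarrow> 'a) \<Rightarrow> bool" where
  "automorphism G f \<longleftrightarrow>
    bij_betw f (pverts G) (pverts G) \<and>
    (\<forall>x \<in> pverts G. \<forall>y \<in> pverts G. (f x, f y) \<in> parcs G \<longleftrightarrow> (x, y) \<in> parcs G)"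

definition determining_set :: "'a pair_pre_digraph \<Rightarrow> 'a set \<Rightarrow> bool" where
  "determining_set G S \<longleftrightarrow>
    S \<subseteq> pverts G \<and>
    (\<forall>f. automorphism G f \<and> (\<forall>x \<in> S. f x = x) \<longrightarrow> (\<forall>x \<in> pverts G. f x = x))"

definition determining_number :: "'a pair_pre_digraph \<Rightarrow> nat" where
  "determining_number G = (LEAST k. \<exists>S. determining_set G S \<and> card S = k)"

text \<open>
  \<open>Copy v s\<close> is the vertex at level \<open>s\<close> above \<open>v\<close>; level 0 is the original graph.
\<close>

datatype 'a myc_vertex = Copy 'a nat | Apex

definition gen_mycielskian :: "nat \<Rightarrow> 'a pair_pre_digraph \<Rightarrow> 'a myc_vertex pair_pre_digraph" where
  "gen_mycielskian t G =
    \<lparr> pverts = {Copy v s | v s. v \<in> pverts G \<and> s \<le> t} \<union> {Apex},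
      parcs =
        {(Copy x 0, Copy y 0) | x y. (x, y) \<in> parcs G} \<union>
        {(Copy x s, Copy y (Suc s)) | x y s. (x, y) \<in> parcs G \<and> s < t} \<union>
        {(Copy y (Suc s), Copy x s) | x y s. (x, y) \<in> parcs G \<and> s < t} \<union>
        {(Copy v t, Apex) | v. v \<in> pverts G} \<union>
        {(Apex, Copy v t) | v. v \<in> pverts G} \<rparr>"

lemma equiv_twin_rel: "equiv (pverts G) (twin_rel G)"
  by (rule equivI) (auto simp: twin_rel_def twins_def refl_on_def sym_def trans_def)

lemma twin_quotient_arc_iff:
  assumes "pair_graph G" "x \<in> pverts G" "z \<in> pverts G"
  shows "(twin_rel G `` {x}, twin_rel G `` {z}) \<in> parcs (twin_quotient G) \<longleftrightarrow> (x, z) \<in> parcs G"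
proof
  interpret pair_graph G by fact
  assume "(twin_rel G `` {x}, twin_rel G `` {z}) \<in> parcs (twin_quotient G)"
  then obtain a b where ab: "(a, b) \<in> parcs G"
    "twin_rel G `` {x} = twin_rel G `` {a}" "twin_rel G `` {z} = twin_rel G `` {b}"
    by (auto simp: twin_quotient_def)
  then have V: "a \<in> pverts G" "b \<in> pverts G"
    by (auto dest: in_arcsD1 in_arcsD2)
  have "(x, a) \<in> twin_rel G" "(z, b) \<in> twin_rel G"
    using ab V assms eq_equiv_class_iff[OF equiv_twin_rel] by metis+
  then have "open_nbhd G x = open_nbhd G a" "open_nbhd G z = open_nbhd G b"
    by (auto simp: twin_rel_def twins_def)
  then have "(x, b) \<in> parcs G" and *: "\<And>u. (b, u) \<in> parcs G \<Longrightarrow> (z, u) \<in> parcs G"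
    using ab(1) by (auto simp: open_nbhd_def)
  then show "(x, z) \<in> parcs G"
    using arcs_symmetric by blast
qed (auto simp: twin_quotient_def)

lemma pair_graph_twin_quotient:
  assumes "pair_graph G"
  shows "pair_graph (twin_quotient G)"
proof -
  interpret pair_graph G by fact
  have fin: "finite (pverts (twin_quotient G))"
    using pair_finite_verts by (simp add: twin_quotient_def quotient_def)
  have sub: "parcs (twin_quotient G) \<subseteq> pverts (twin_quotient G) \<times> pverts (twin_quotient G)"
    by (auto simp: twin_quotient_def quotient_def dest: in_arcsD1 in_arcsD2)
  have loop: "(c, c) \<notin> parcs (twin_quotient G)" for c
  proof
    assume c: "(c, c) \<in> parcs (twin_quotient G)"
    then have "c \<in> pverts G // twin_rel G" using sub by (auto simp: twin_quotient_def)
    then obtain x where "x \<in> pverts G" "c = twin_rel G `` {x}" by (auto elim: quotientE)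
    with c twin_quotient_arc_iff[OF assms, of x x] pair_no_loops[of "(x, x)"] show False by auto
  qed
  have "sym (parcs (twin_quotient G))"
    by (auto simp: twin_quotient_def sym_def intro: arcs_symmetric)
  moreover have "finite (parcs (twin_quotient G))"
    using fin sub by (meson finite_SigmaI finite_subset)
  ultimately show ?thesis using fin sub loop
    by unfold_locales (auto simp: symmetric_def)
qed

lemma equals_twin_quotient_iff:
  assumes "pair_graph G"
  shows "equals_twin_quotient G \<longleftrightarrow> (\<nexists>x y. twins G x y)"
proof
  assume eq: "equals_twin_quotient G"
  show "\<nexists>x y. twins G x y"
  proof (intro notI, elim exE)
    fix x y assume tw: "twins G x y"
    then have "twin_rel G `` {x} \<in> pverts G // twin_rel G"
      by (auto simp: twins_def intro: quotientI)
    then have "twin_rel G `` {x} \<in> (\<lambda>x. {x}) ` pverts G"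
      using eq by (simp add: equals_twin_quotient_def twin_quotient_def)
    then obtain z where z: "twin_rel G `` {x} = {z}" by blast
    have "x \<in> twin_rel G `` {x}" "y \<in> twin_rel G `` {x}"
      using tw by (auto simp: twin_rel_def twins_def)
    then have "x = y" unfolding z by simp
    with tw show False by (simp add: twins_def)
  qed
next
  interpret pair_graph G by fact
  assume "\<nexists>x y. twins G x y"
  then have cls: "twin_rel G `` {x} = {x}" if "x \<in> pverts G" for x
    using that by (auto simp: twin_rel_def)
  have "pverts G // twin_rel G = (\<lambda>x. {x}) ` pverts G"
    using cls by (auto simp: quotient_def)
  moreover have "{(twin_rel G `` {x}, twin_rel G `` {z}) | x z. (x, z) \<in> parcs G}
      = (\<lambda>(x, y). ({x}, {y})) ` parcs G"
  proof (intro equalityI subsetI)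
    fix c assume "c \<in> {(twin_rel G `` {x}, twin_rel G `` {z}) | x z. (x, z) \<in> parcs G}"
    then obtain x z where "(x, z) \<in> parcs G" "c = (twin_rel G `` {x}, twin_rel G `` {z})"
      by blast
    then show "c \<in> (\<lambda>(x, y). ({x}, {y})) ` parcs G"
      using cls in_arcsD1 in_arcsD2 by (intro image_eqI[of _ _ "(x, z)"]) simp_all
  next
    fix c assume "c \<in> (\<lambda>(x, y). ({x}, {y})) ` parcs G"
    then obtain x z where "(x, z) \<in> parcs G" "c = ({x}, {z})" by auto
    moreover from this have "c = (twin_rel G `` {x}, twin_rel G `` {z})"
      using cls in_arcsD1 in_arcsD2 by simp
    ultimately show "c \<in> {(twin_rel G `` {x}, twin_rel G `` {z}) | x z. (x, z) \<in> parcs G}"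
      by blast
  qed
  ultimately show "equals_twin_quotient G"
    by (simp add: equals_twin_quotient_def twin_quotient_def)
qed

lemma pair_graph_gen_mycielskian:
  assumes "pair_graph G"
  shows "pair_graph (gen_mycielskian t G)"
proof -
  interpret pair_graph G by fact
  have "pverts (gen_mycielskian t G) = (\<lambda>(v, s). Copy v s) ` (pverts G \<times> {..t}) \<union> {Apex}"
    by (auto simp: gen_mycielskian_def)
  then have fin: "finite (pverts (gen_mycielskian t G))"
    by (simp add: pair_finite_verts)
  have sub: "parcs (gen_mycielskian t G)
      \<subseteq> pverts (gen_mycielskian t G) \<times> pverts (gen_mycielskian t G)"
    by (auto simp: gen_mycielskian_def dest: in_arcsD1 in_arcsD2)
  have "(c, c) \<notin> parcs (gen_mycielskian t G)" for c
    by (auto simp: gen_mycielskian_def dest: pair_no_loops)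
  moreover have "sym (parcs (gen_mycielskian t G))"
    by (rule symI) (auto simp: gen_mycielskian_def intro: arcs_symmetric)
  moreover have "finite (parcs (gen_mycielskian t G))"
    using fin sub by (meson finite_SigmaI finite_subset)
  ultimately show ?thesis using fin sub
    by unfold_locales (auto simp: symmetric_def)
qed

end

theory Submission
  imports Defs
begin

text \<open>
  Lower bound: exchanging two twins is an automorphism, so a determining set of the Mycielskian
  restricts to a twin cover of \<open>G\<close> on each of its \<open>t + 1\<close> levels.

  Upper bound: take a minimum twin cover on every level and, on level 0, representatives of a
  determining set of the quotient. If an automorphism fixes the whole column above one vertex
  \<open>v\<close>, then it stabilises the neighbourhoods of the vertices in this column, hence successively
  the copies of \<open>N(v)\<close> on the levels 0, 1, 2, ..., and finally the apex. It follows that it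
  preserves all levels. On level 0 it induces an automorphism of \<open>G\<close> that is trivial on the
  quotient, so it moves vertices only within twin classes and the twin cover makes it trivial;
  triviality then propagates upwards, because two consecutive levels determine each other up to
  twins.
\<close>

section \<open>Determining sets and twins\<close>

lemma determining_number_le:
  "determining_set H S \<Longrightarrow> determining_number H \<le> card S"
  unfolding determining_number_def by (rule Least_le) blast

lemma determining_number_attained:
  obtains S where "determining_set H S" "card S = determining_number H"
proof -
  \<comment> \<open>The full vertex set is determining, so the \<open>LEAST\<close> ranges over a
    nonempty set of cardinalities.\<close>
  have "determining_set H (pverts H)" by (auto simp: determining_set_def)
  then have "\<exists>S. determining_set H S \<and> card S = determining_number H"
    unfolding determining_number_def
    by (intro LeastI_ex[of "\<lambda>k. \<exists>S. determining_set H S \<and> card S = k"]) blast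
  then show thesis using that by blast
qed

lemma automorphism_image_open_nbhd:
  assumes "pair_graph H" "automorphism H f" "u \<in> pverts H"
  shows "f ` open_nbhd H u = open_nbhd H (f u)"
proof -
  interpret pair_graph H by fact
  have surj: "f ` pverts H = pverts H"
    and pres: "\<And>x y. x \<in> pverts H \<Longrightarrow> y \<in> pverts H \<Longrightarrow> (f x, f y) \<in> parcs H \<longleftrightarrow> (x, y) \<in> parcs H"
    using assms(2) by (auto simp: automorphism_def bij_betw_def)
  show ?thesis
  proof (intro equalityI subsetI)
    fix z assume "z \<in> f ` open_nbhd H u"
    then show "z \<in> open_nbhd H (f u)"
      using pres assms(3) in_arcsD2 by (auto simp: open_nbhd_def)
  next
    fix z assume z: "z \<in> open_nbhd H (f u)"
    then have "z \<in> pverts H" using in_arcsD2 by (auto simp: open_nbhd_def)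
    then obtain y where "y \<in> pverts H" "z = f y" using surj by blast
    then show "z \<in> f ` open_nbhd H u"
      using z pres assms(3) by (auto simp: open_nbhd_def)
  qed
qed

lemma finite_determining_set:
  assumes "pair_graph H" "determining_set H S"
  shows "finite S"
proof -
  interpret pair_graph H by fact
  show ?thesis using assms(2) pair_finite_verts by (auto simp: determining_set_def intro: finite_subset)
qed

lemma determining_set_imp_twin_cover:
  assumes "pair_graph H" "determining_set H S"
  shows "twin_cover H S"
proof -
  interpret pair_graph H by fact
  have "x \<in> S \<or> y \<in> S" if tw: "twins H x y" for x y
  proof (rule ccontr)
    assume n: "\<not> (x \<in> S \<or> y \<in> S)"
    \<comment> \<open>The transposition of the twins \<open>x\<close> and \<open>y\<close>: it fixes
      \<open>S\<close> pointwise when \<open>S\<close> misses both.\<close>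
    define f where "f = id(x := y, y := x)"
    have xy: "x \<in> pverts H" "y \<in> pverts H" "x \<noteq> y"
      and nb: "\<And>u. (x, u) \<in> parcs H \<longleftrightarrow> (y, u) \<in> parcs H"
      using tw by (auto simp: twins_def open_nbhd_def)
    \<comment> \<open>Being twins compares outgoing arcs; symmetry gives the same for incoming arcs,
      and both are needed to see that \<open>f\<close> preserves arcs.\<close>
    have nb': "(u, x) \<in> parcs H \<longleftrightarrow> (u, y) \<in> parcs H" for u
      using nb arcs_symmetric by blast
    have "bij_betw f (pverts H) (pverts H)"
      by (rule bij_betw_byWitness[where f' = f]) (use xy in \<open>auto simp: f_def\<close>)
    moreover have "(f u, f v) \<in> parcs H \<longleftrightarrow> (u, v) \<in> parcs H" for u v
      using nb nb' by (auto simp: f_def)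
    ultimately have "automorphism H f" by (simp add: automorphism_def)
    moreover have "\<forall>u \<in> S. f u = u" using n by (auto simp: f_def)
    ultimately have "f x = x" using assms(2) xy(1) unfolding determining_set_def by blast
    then show False using xy(3) by (simp add: f_def)
  qed
  then show ?thesis using assms(2) by (auto simp: twin_cover_def determining_set_def)
qed

text \<open>If \<open>g\<close> moved \<open>x\<close> to a twin, then \<open>x\<close> would lie
  outside \<open>T\<close>, so \<open>g x\<close> would lie in \<open>T\<close> and be fixed, and
  \<open>x\<close> and \<open>g x\<close> would have the same image. Only injectivity and one pair
  of neighbourhoods enter, so that the argument also serves for the action on a single upper level,
  which is not known in advance to be an automorphism of \<open>G\<close>.\<close>

lemma twin_cover_fixed:
  assumes "twin_cover G T" "inj_on g (pverts G)" "\<And>v. v \<in> T \<Longrightarrow> g v = v"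
    and "x \<in> pverts G" "g x \<in> pverts G" "open_nbhd G (g x) = open_nbhd G x"
  shows "g x = x"
proof (rule ccontr)
  assume ne: "g x \<noteq> x"
  then have "twins G (g x) x" using assms by (auto simp: twins_def)
  then have "g x \<in> T" using assms(1,3) ne by (auto simp: twin_cover_def)
  then have "g (g x) = g x" by (rule assms(3))
  then show False using inj_onD[OF assms(2)] assms(4,5) ne by blast
qed

section \<open>Automorphisms and the twin quotient\<close>

lemma twin_rel_iff:
  "(x, y) \<in> twin_rel G \<longleftrightarrow> x \<in> pverts G \<and> y \<in> pverts G \<and> open_nbhd G x = open_nbhd G y"
  by (auto simp: twin_rel_def twins_def)

lemma automorphism_twin_rel_iff:
  assumes "pair_graph G" "automorphism G f" "x \<in> pverts G" "y \<in> pverts G"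
  shows "(f x, f y) \<in> twin_rel G \<longleftrightarrow> (x, y) \<in> twin_rel G"
proof -
  interpret pair_graph G by fact
  have bij: "inj_on f (pverts G)" "f ` pverts G = pverts G"
    using assms(2) by (auto simp: automorphism_def bij_betw_def)
  have sub: "open_nbhd G u \<subseteq> pverts G" for u
    by (auto simp: open_nbhd_def dest: in_arcsD2)
  show ?thesis
    using assms(3,4) bij inj_on_image_eq_iff[OF bij(1) sub sub]
    by (auto simp: twin_rel_iff automorphism_image_open_nbhd[OF assms(1,2), symmetric])
qed

lemma automorphism_image_twin_class:
  assumes "pair_graph G" "automorphism G f" "x \<in> pverts G"
  shows "f ` (twin_rel G `` {x}) = twin_rel G `` {f x}"
proof -
  have surj: "f ` pverts G = pverts G"
    using assms(2) by (auto simp: automorphism_def bij_betw_def)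
  show ?thesis
  proof (intro equalityI subsetI)
    fix z assume "z \<in> f ` (twin_rel G `` {x})"
    then obtain y where "z = f y" "(x, y) \<in> twin_rel G" by blast
    then show "z \<in> twin_rel G `` {f x}"
      using automorphism_twin_rel_iff[OF assms, of y] by (simp add: twin_rel_iff)
  next
    fix z assume z: "z \<in> twin_rel G `` {f x}"
    then have "z \<in> pverts G" by (simp add: twin_rel_iff)
    then obtain y where y: "z = f y" "y \<in> pverts G" using surj by blast
    then have "(x, y) \<in> twin_rel G"
      using z automorphism_twin_rel_iff[OF assms y(2)] by simp
    then show "z \<in> f ` (twin_rel G `` {x})" using y(1) by blast
  qed
qed

text \<open>Automorphisms carry twin classes onto twin classes, and adjacency of two classes can be
  tested on any representatives.\<close>

lemma automorphism_twin_quotient: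
  assumes "pair_graph G" "automorphism G f"
  shows "automorphism (twin_quotient G) ((`) f)"
proof -
  interpret pair_graph G by fact
  have bij: "inj_on f (pverts G)" "f ` pverts G = pverts G"
    and pres: "\<And>x y. x \<in> pverts G \<Longrightarrow> y \<in> pverts G \<Longrightarrow> (f x, f y) \<in> parcs G \<longleftrightarrow> (x, y) \<in> parcs G"
    using assms(2) by (auto simp: automorphism_def bij_betw_def)
  have V: "pverts (twin_quotient G) = (\<lambda>x. twin_rel G `` {x}) ` pverts G"
    by (auto simp: twin_quotient_def quotient_def)
  have fV: "f x \<in> pverts G" if "x \<in> pverts G" for x using bij(2) that by blast
  note cls = automorphism_image_twin_class[OF assms]
  \<comment> \<open>Classes lie inside the set where \<open>f\<close> is injective, so distinct
    classes have distinct images.\<close>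
  have "C \<subseteq> pverts G" if "C \<in> pverts (twin_quotient G)" for C
    using that by (auto simp: V twin_rel_iff)
  then have "inj_on ((`) f) (pverts (twin_quotient G))"
    by (intro inj_onI) (use inj_on_image_eq_iff[OF bij(1)] in blast)
  moreover have "(`) f ` pverts (twin_quotient G) = (\<lambda>x. twin_rel G `` {x}) ` f ` pverts G"
    unfolding V image_image by (rule image_cong) (auto simp: cls)
  ultimately have "bij_betw ((`) f) (pverts (twin_quotient G)) (pverts (twin_quotient G))"
    by (simp add: bij_betw_def V bij(2))
  moreover have "(f ` C, f ` C') \<in> parcs (twin_quotient G) \<longleftrightarrow> (C, C') \<in> parcs (twin_quotient G)"
    if CC: "C \<in> pverts (twin_quotient G)" "C' \<in> pverts (twin_quotient G)" for C C'
  proof -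
    obtain x y where xy: "x \<in> pverts G" "y \<in> pverts G"
        "C = twin_rel G `` {x}" "C' = twin_rel G `` {y}"
      using CC by (auto simp: V)
    show ?thesis unfolding xy(3,4) cls[OF xy(1)] cls[OF xy(2)]
      by (simp add: twin_quotient_arc_iff[OF assms(1)] xy(1,2) fV pres)
  qed
  ultimately show ?thesis by (simp add: automorphism_def)
qed

text \<open>Pick one representative from each class in \<open>D\<close>. Fixing a representative
  stabilises its class, so the induced automorphism of the quotient is trivial; every vertex then
  stays in its own twin class, and the twin cover excludes movement inside a class.\<close>

lemma determining_set_from_twin_quotient:
  assumes "pair_graph G" "twin_cover G T" "determining_set (twin_quotient G) D"
  obtains D' where "determining_set G (T \<union> D')" "card D' \<le> card D"
proof
  interpret pair_graph G by fact
  define rep where "rep C = (SOME x. x \<in> C)" for C :: "'a set"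
  have V: "pverts (twin_quotient G) = (\<lambda>x. twin_rel G `` {x}) ` pverts G"
    by (auto simp: twin_quotient_def quotient_def)
  have D: "D \<subseteq> pverts (twin_quotient G)" using assms(3) by (simp add: determining_set_def)
  have fin: "finite D" using D pair_finite_verts unfolding V by (meson finite_imageI finite_subset)
  show "card (rep ` D) \<le> card D" using fin by (rule card_image_le)
  have rep: "rep C \<in> pverts G" "C = twin_rel G `` {rep C}" if "C \<in> D" for C
  proof -
    obtain x where x: "x \<in> pverts G" "C = twin_rel G `` {x}" using \<open>C \<in> D\<close> D by (auto simp: V)
    then have "x \<in> C" by (simp add: twin_rel_iff)
    then have "rep C \<in> C" unfolding rep_def by (rule someI)
    then have r: "(x, rep C) \<in> twin_rel G" using x by simp
    then show "rep C \<in> pverts G" by (simp add: twin_rel_iff)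
    show "C = twin_rel G `` {rep C}"
      using equiv_class_eq[OF equiv_twin_rel r] x(2) by simp
  qed
  have "f x = x" if f: "automorphism G f" "\<forall>x \<in> T \<union> rep ` D. f x = x" and x: "x \<in> pverts G" for f x
  proof (rule twin_cover_fixed[OF assms(2)])
    note cls = automorphism_image_twin_class[OF assms(1) f(1)]
    show "inj_on f (pverts G)" "f x \<in> pverts G"
      using f(1) x by (auto simp: automorphism_def bij_betw_def)
    have "f ` C = C" if "C \<in> D" for C
      using cls[OF rep(1)[OF that]] rep(2)[OF that] f(2) that by auto
    then have "automorphism (twin_quotient G) ((`) f) \<and> (\<forall>C \<in> D. f ` C = C)"
      using automorphism_twin_quotient[OF assms(1) f(1)] by simp
    then have "\<forall>C \<in> pverts (twin_quotient G). f ` C = C"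
      by (rule assms(3)[unfolded determining_set_def, THEN conjunct2, THEN spec, THEN mp])
    moreover have "twin_rel G `` {x} \<in> pverts (twin_quotient G)" using x by (simp add: V)
    ultimately have "f ` (twin_rel G `` {x}) = twin_rel G `` {x}" by (rule bspec)
    then have "twin_rel G `` {f x} = twin_rel G `` {x}" using cls[OF x] by simp
    then have "(f x, x) \<in> twin_rel G"
      using eq_equiv_class_iff[OF equiv_twin_rel] x \<open>f x \<in> pverts G\<close> by metis
    then show "open_nbhd G (f x) = open_nbhd G x" by (simp add: twin_rel_iff)
  qed (use f(2) x in auto)
  then show "determining_set G (T \<union> rep ` D)"
    using assms(2) rep(1) by (auto simp: determining_set_def twin_cover_def)
qed

section \<open>Generalized Mycielskians\<close>

lemma pverts_gen_mycielskian [simp]: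
  "Copy v s \<in> pverts (gen_mycielskian t G) \<longleftrightarrow> v \<in> pverts G \<and> s \<le> t"
  "Apex \<in> pverts (gen_mycielskian t G)"
  by (auto simp: gen_mycielskian_def)

lemma parcs_gen_mycielskian:
  assumes "pair_graph G"
  shows "(Copy x s, Copy y r) \<in> parcs (gen_mycielskian t G) \<longleftrightarrow>
      (x, y) \<in> parcs G \<and> (s = 0 \<and> r = 0 \<or> r = Suc s \<and> s < t \<or> s = Suc r \<and> r < t)"
    and "(Copy x s, Apex) \<in> parcs (gen_mycielskian t G) \<longleftrightarrow> x \<in> pverts G \<and> s = t"
    and "(Apex, Copy x s) \<in> parcs (gen_mycielskian t G) \<longleftrightarrow> x \<in> pverts G \<and> s = t"
    and "(Apex, Apex) \<notin> parcs (gen_mycielskian t G)"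
proof -
  interpret pair_graph G by fact
  show "(Copy x s, Copy y r) \<in> parcs (gen_mycielskian t G) \<longleftrightarrow>
      (x, y) \<in> parcs G \<and> (s = 0 \<and> r = 0 \<or> r = Suc s \<and> s < t \<or> s = Suc r \<and> r < t)"
    by (auto simp: gen_mycielskian_def intro: arcs_symmetric)
qed (auto simp: gen_mycielskian_def)

section \<open>The lower bound, level by level\<close>

lemma twins_gen_mycielskian:
  assumes "pair_graph G" "twins G x y" "s \<le> t"
  shows "twins (gen_mycielskian t G) (Copy x s) (Copy y s)"
proof -
  \<comment> \<open>The neighbours of \<open>Copy x s\<close> depend on \<open>x\<close> only
    through its neighbourhood in \<open>G\<close>, apart from \<open>Apex\<close>, which is adjacent
    to the whole top level.\<close>
  have "(Copy x s, u) \<in> parcs (gen_mycielskian t G) \<longleftrightarrow> (Copy y s, u) \<in> parcs (gen_mycielskian t G)" for u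
    using assms(2) by (cases u) (auto simp: parcs_gen_mycielskian[OF assms(1)] twins_def open_nbhd_def)
  then show ?thesis using assms(2,3) by (auto simp: twins_def open_nbhd_def)
qed

lemma twin_cover_level:
  assumes "pair_graph G" "twin_cover (gen_mycielskian t G) S" "s \<le> t"
  shows "twin_cover G {v. Copy v s \<in> S}"
  using assms(2) twins_gen_mycielskian[OF assms(1) _ assms(3)]
  by (fastforce simp: twin_cover_def)

text \<open>The \<open>t + 1\<close> slices of \<open>S\<close> are disjoint, and each has at least
  \<open>card T\<close> elements by minimality. The hypothesis speaks of slices rather than of a
  determining set, so that it also applies to a determining set with one vertex removed.\<close>

lemma card_ge_of_level_twin_covers:
  assumes "minimum_twin_cover G T" "finite S" "\<And>s. s \<le> t \<Longrightarrow> twin_cover G {v. Copy v s \<in> S}"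
  shows "(t + 1) * card T \<le> card S"
proof -
  define L where "L s = (\<lambda>v. Copy v s) ` {v. Copy v s \<in> S}" for s
  have sub: "L s \<subseteq> S" for s by (auto simp: L_def)
  have "card T \<le> card (L s)" if "s \<le> t" for s
  proof -
    have "card (L s) = card {v. Copy v s \<in> S}"
      unfolding L_def by (rule card_image) (auto intro: inj_onI)
    then show ?thesis using assms(1) assms(3)[OF that]
      by (auto simp: minimum_twin_cover_def is_arg_min_linorder)
  qed
  then have "(\<Sum>s\<le>t. card T) \<le> (\<Sum>s\<le>t. card (L s))" by (intro sum_mono) auto
  also have "\<dots> = card (\<Union>s\<le>t. L s)"
    by (rule card_UN_disjoint[symmetric]) (auto simp: L_def finite_subset[OF sub assms(2), unfolded L_def])
  also have "\<dots> \<le> card S" using sub by (intro card_mono assms(2)) auto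
  finally show ?thesis by simp
qed

theorem gen_mycielskian_determining_number_ge:
  assumes "pair_graph G" "minimum_twin_cover G T"
  shows "(t + 1) * card T \<le> determining_number (gen_mycielskian t G)"
proof -
  note M = pair_graph_gen_mycielskian[OF assms(1), of t]
  obtain S where S: "determining_set (gen_mycielskian t G) S"
      "card S = determining_number (gen_mycielskian t G)"
    by (rule determining_number_attained)
  have "finite S" by (rule finite_determining_set[OF M S(1)])
  then have "(t + 1) * card T \<le> card S"
    using assms(2) twin_cover_level[OF assms(1) determining_set_imp_twin_cover[OF M S(1)]]
    by (intro card_ge_of_level_twin_covers)
  then show ?thesis by (simp add: S(2))
qed

section \<open>Lifted automorphisms and a strict lower bound\<close>

lemma automorphism_gen_mycielskian:
  assumes "pair_graph G" "automorphism G g"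
  shows "automorphism (gen_mycielskian t G) (case_myc_vertex (\<lambda>v. Copy (g v)) Apex)"
    (is "automorphism ?M ?h")
proof -
  have bij: "inj_on g (pverts G)" "g ` pverts G = pverts G"
    and pres: "\<And>x y. x \<in> pverts G \<Longrightarrow> y \<in> pverts G \<Longrightarrow> (g x, g y) \<in> parcs G \<longleftrightarrow> (x, y) \<in> parcs G"
    using assms(2) by (auto simp: automorphism_def bij_betw_def)
  have gV: "g v \<in> pverts G" if "v \<in> pverts G" for v using bij(2) that by blast
  have "inj_on ?h (pverts ?M)"
    by (rule inj_onI) (auto split: myc_vertex.splits dest: inj_onD[OF bij(1)])
  moreover have "?h ` pverts ?M = pverts ?M"
  proof (intro equalityI subsetI)
    fix u assume "u \<in> ?h ` pverts ?M"
    then show "u \<in> pverts ?M" by (auto split: myc_vertex.splits intro: gV)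
  next
    fix u assume u: "u \<in> pverts ?M"
    show "u \<in> ?h ` pverts ?M"
    proof (cases u)
      case (Copy v s)
      then have "v \<in> g ` pverts G" "s \<le> t" using u bij(2) by auto
      then obtain v' where "v' \<in> pverts G" "v = g v'" by blast
      then show ?thesis using Copy \<open>s \<le> t\<close> by (intro image_eqI[of _ _ "Copy v' s"]) auto
    next
      case Apex
      then show ?thesis by (intro image_eqI[of _ _ Apex]) auto
    qed
  qed
  moreover have "(?h u, ?h v) \<in> parcs ?M \<longleftrightarrow> (u, v) \<in> parcs ?M"
    if "u \<in> pverts ?M" "v \<in> pverts ?M" for u v
    using that by (cases u; cases v) (auto simp: parcs_gen_mycielskian[OF assms(1)] pres gV)
  ultimately show ?thesis by (simp add: automorphism_def bij_betw_def)
qed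

text \<open>The lift of \<open>g\<close> is nontrivial, so a determining set \<open>S\<close>
  contains some \<open>u\<close> that it moves. The vertex of \<open>G\<close> below
  \<open>u\<close> has no twin, hence deleting \<open>u\<close> leaves every slice a twin cover, and
  \<open>S\<close> has at least one element beyond the lower bound.\<close>

lemma gen_mycielskian_determining_number_gt:
  assumes "pair_graph G" "minimum_twin_cover G T" "automorphism G g"
    and "\<And>x y. twins G x y \<Longrightarrow> g x = x"
    and "v \<in> pverts G" "g v \<noteq> v"
  shows "(t + 1) * card T < determining_number (gen_mycielskian t G)"
proof -
  note M = pair_graph_gen_mycielskian[OF assms(1), of t]
  obtain S where S: "determining_set (gen_mycielskian t G) S"
      "card S = determining_number (gen_mycielskian t G)"
    by (rule determining_number_attained)
  have fin: "finite S" by (rule finite_determining_set[OF M S(1)])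
  define h where "h = case_myc_vertex (\<lambda>v. Copy (g v)) Apex"
  have "automorphism (gen_mycielskian t G) h"
    unfolding h_def by (rule automorphism_gen_mycielskian[OF assms(1,3)])
  moreover have "Copy v 0 \<in> pverts (gen_mycielskian t G)" "h (Copy v 0) \<noteq> Copy v 0"
    using assms(5,6) by (auto simp: h_def)
  ultimately obtain u where u: "u \<in> S" "h u \<noteq> u"
    using S(1) unfolding determining_set_def by blast
  then obtain x r where x: "u = Copy x r" "g x \<noteq> x"
    by (cases u) (auto simp: h_def)
  then have no_twin: "\<not> twins G x y" "\<not> twins G y x" for y
    using assms(4) by (auto simp: twins_def)
  have "twin_cover G {v. Copy v s \<in> S - {u}}" if "s \<le> t" for s
    using twin_cover_level[OF assms(1) determining_set_imp_twin_cover[OF M S(1)] that] no_twin x(1)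
    by (auto simp: twin_cover_def)
  then have "(t + 1) * card T \<le> card (S - {u})"
    using assms(2) fin by (intro card_ge_of_level_twin_covers) auto
  also have "\<dots> < card S" using u(1) fin by (intro card_Diff1_less)
  finally show ?thesis by (simp add: S(2))
qed

section \<open>The upper bound: rigidity of columns and levels\<close>

lemma automorphism_fixes_Apex:
  assumes "pair_graph G" "t \<ge> 1" "v \<in> pverts G"
    and f: "automorphism (gen_mycielskian t G) f" "\<And>s. s \<le> t \<Longrightarrow> f (Copy v s) = Copy v s"
  shows "f Apex = Apex"
proof -
  interpret pair_graph G by fact
  let ?M = "gen_mycielskian t G"
  note M = pair_graph_gen_mycielskian[OF assms(1), of t]
  note arc = parcs_gen_mycielskian[OF assms(1)]
  \<comment> \<open>The copy of the neighbourhood of \<open>v\<close> on level \<open>k\<close>,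
    with \<open>Apex\<close> in the role of level \<open>t + 1\<close>. This makes the neighbourhood
    of \<open>Copy v (Suc k)\<close> equal to \<open>N k\<close> together with
    \<open>N (Suc (Suc k))\<close> even at the top of the column.\<close>
  define N where "N k = (if k \<le> t then (\<lambda>x. Copy x k) ` open_nbhd G v else {Apex})" for k
  have sub: "open_nbhd G v \<subseteq> pverts G" by (auto simp: open_nbhd_def dest: in_arcsD2)
  have inj: "inj_on f (pverts ?M)" using f(1) by (auto simp: automorphism_def bij_betw_def)
  have NM: "N k \<subseteq> pverts ?M" for k using sub by (auto simp: N_def)
  have nb: "f ` open_nbhd ?M (Copy v s) = open_nbhd ?M (Copy v s)" if "s \<le> t" for s
    using automorphism_image_open_nbhd[OF M f(1), of "Copy v s"] that assms(3) f(2) by simp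
  have nb0: "open_nbhd ?M (Copy v 0) = N 0 \<union> N 1"
  proof (intro set_eqI)
    fix u show "u \<in> open_nbhd ?M (Copy v 0) \<longleftrightarrow> u \<in> N 0 \<union> N 1"
      using assms(2) by (cases u) (auto simp: open_nbhd_def N_def arc)
  qed
  have nbS: "open_nbhd ?M (Copy v (Suc k)) = N k \<union> N (Suc (Suc k))" if "Suc k \<le> t" for k
  proof (intro set_eqI)
    fix u show "u \<in> open_nbhd ?M (Copy v (Suc k)) \<longleftrightarrow> u \<in> N k \<union> N (Suc (Suc k))"
      using that assms(3) by (cases u) (auto simp: open_nbhd_def N_def arc)
  qed
  \<comment> \<open>The bound \<open>k \<le> Suc t\<close> matters: beyond it \<open>N\<close> stays
    constantly \<open>{Apex}\<close>.\<close>
  have disj: "N j \<inter> N k = {}" if "j < k" "k \<le> Suc t" for j k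
    using that by (auto simp: N_def)
  have diff: "f ` B = B" if "f ` (A \<union> B) = A \<union> B" "f ` A = A" "A \<inter> B = {}"
      "A \<subseteq> pverts ?M" "B \<subseteq> pverts ?M" for A B
  proof -
    have "f ` ((A \<union> B) - A) = f ` (A \<union> B) - f ` A"
      using that by (intro inj_on_image_set_diff[OF inj]) auto
    moreover have "(A \<union> B) - A = B" using that(3) by auto
    ultimately show ?thesis using that(1,2) by simp
  qed
  \<comment> \<open>Level 0 is adjacent to itself, so the neighbourhoods of \<open>Copy v 0\<close>
    and \<open>Copy v 1\<close> meet exactly in \<open>N 0\<close>; \<open>t \<ge> 1\<close> ensures
    that \<open>Copy v 1\<close> exists.\<close>
  have N0: "f ` N 0 = N 0"
  proof -
    have eq: "N 0 = open_nbhd ?M (Copy v 0) \<inter> open_nbhd ?M (Copy v 1)"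
      using disj[of 0 1] disj[of 0 2] disj[of 1 2] nb0 nbS[of 0] assms(2)
      by (auto simp: numeral_2_eq_2)
    have "f ` (open_nbhd ?M (Copy v 0) \<inter> open_nbhd ?M (Copy v 1)) =
        f ` open_nbhd ?M (Copy v 0) \<inter> f ` open_nbhd ?M (Copy v 1)"
      using NM nb0 nbS[of 0] assms(2) by (intro inj_on_image_Int[OF inj]) auto
    also have "\<dots> = open_nbhd ?M (Copy v 0) \<inter> open_nbhd ?M (Copy v 1)"
      using nb[of 0] nb[of 1] assms(2) by simp
    finally show ?thesis by (simp only: eq[symmetric])
  qed
  \<comment> \<open>Two consecutive sets are carried along because a neighbourhood links the indices
    \<open>k\<close> and \<open>k + 2\<close>. At \<open>k = t\<close> the second one is
    \<open>{Apex}\<close>.\<close>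
  have step: "k \<le> t \<longrightarrow> f ` N k = N k \<and> f ` N (Suc k) = N (Suc k)" for k
  proof (induction k)
    case 0
    have "f ` N 1 = N 1"
      by (rule diff[OF _ N0]) (use nb[of 0] nb0 disj[of 0 1] NM in auto)
    then show ?case using N0 by simp
  next
    case (Suc k)
    have "f ` N (Suc (Suc k)) = N (Suc (Suc k))" if "Suc k \<le> t"
      by (rule diff[of "N k"])
        (use that Suc nb[of "Suc k"] nbS[of k] disj[of k "Suc (Suc k)"] NM in auto)
    then show ?case using Suc by auto
  qed
  show ?thesis using step[of t] by (simp add: N_def)
qed

text \<open>From the fixed apex one descends: the neighbours of a level above 0 lie on the two
  adjacent layers, so removing the upper one leaves the lower one. Without isolated vertices, all of
  the lower level is reached in this way.\<close>

lemma automorphism_preserves_level: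
  assumes "pair_graph G" "no_isolated_vertices G" "t \<ge> 1"
    and f: "automorphism (gen_mycielskian t G) f" "f Apex = Apex"
    and "s \<le> t"
  shows "f ` (\<lambda>x. Copy x s) ` pverts G = (\<lambda>x. Copy x s) ` pverts G"
proof -
  interpret pair_graph G by fact
  let ?M = "gen_mycielskian t G"
  note M = pair_graph_gen_mycielskian[OF assms(1), of t]
  interpret M: pair_graph ?M by (rule M)
  note arc = parcs_gen_mycielskian[OF assms(1)]
  \<comment> \<open>Layers counted downwards from the apex: \<open>K 0\<close> is the apex,
    \<open>K 1\<close> is level \<open>t\<close> and \<open>K (t + 1)\<close> is level 0.\<close>
  define K where "K j = (if j = 0 then {Apex} else (\<lambda>x. Copy x (t + 1 - j)) ` pverts G)" for j
  have inj: "inj_on f (pverts ?M)" using f(1) by (auto simp: automorphism_def bij_betw_def)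
  note nb = automorphism_image_open_nbhd[OF M f(1)]
  have KM: "K j \<subseteq> pverts ?M" for j by (auto simp: K_def)
  have K0: "f ` K 0 = K 0" using f(2) by (simp add: K_def)
  have "K 1 = open_nbhd ?M Apex"
  proof (intro set_eqI)
    fix u show "u \<in> K 1 \<longleftrightarrow> u \<in> open_nbhd ?M Apex"
      by (cases u) (auto simp: K_def open_nbhd_def arc)
  qed
  then have K1: "f ` K 1 = K 1" using nb[of Apex] f(2) by simp
  have sub: "(\<Union>u \<in> K (Suc j). open_nbhd ?M u) \<subseteq> pverts ?M" for j
    by (auto simp: open_nbhd_def dest: M.in_arcsD2)
  \<comment> \<open>Since \<open>j < t\<close>, the layer \<open>K (Suc j)\<close> is level
    \<open>t - j\<close>, which is at least 1; so the edges inside level 0 do not interfere.\<close>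
  have K2: "K (Suc (Suc j)) = (\<Union>u \<in> K (Suc j). open_nbhd ?M u) - K j" if "j < t" for j
  proof (intro set_eqI)
    fix u show "u \<in> K (Suc (Suc j)) \<longleftrightarrow> u \<in> (\<Union>u \<in> K (Suc j). open_nbhd ?M u) - K j"
    proof (cases u)
      case (Copy x r)
      have "\<exists>y. (y, x) \<in> parcs G" if "x \<in> pverts G"
        using assms(2) that arcs_symmetric by (fastforce simp: no_isolated_vertices_def open_nbhd_def)
      then show ?thesis using Copy that
        by (auto simp: K_def open_nbhd_def arc dest: in_arcsD1 in_arcsD2)
    next
      case Apex
      then show ?thesis using that by (auto simp: K_def open_nbhd_def arc)
    qed
  qed
  have "j \<le> t \<longrightarrow> f ` K j = K j \<and> f ` K (Suc j) = K (Suc j)" for j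
  proof (induction j)
    case 0
    then show ?case using K0 K1 by simp
  next
    case (Suc j)
    have "f ` K (Suc (Suc j)) = K (Suc (Suc j))" if "Suc j \<le> t"
    proof -
      have "j < t" and IH: "f ` K j = K j" "f ` K (Suc j) = K (Suc j)" using Suc that by auto
      have "f ` K (Suc (Suc j)) = f ` (\<Union>u \<in> K (Suc j). open_nbhd ?M u) - f ` K j"
        unfolding K2[OF \<open>j < t\<close>] using sub KM by (intro inj_on_image_set_diff[OF inj]) auto
      also have "f ` (\<Union>u \<in> K (Suc j). open_nbhd ?M u) = (\<Union>u \<in> K (Suc j). open_nbhd ?M (f u))"
        unfolding image_UN using nb KM by (intro SUP_cong) auto
      also have "\<dots> = (\<Union>u \<in> f ` K (Suc j). open_nbhd ?M u)" by auto
      finally show ?thesis using K2[OF \<open>j < t\<close>] IH by simp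
    qed
    then show ?case using Suc by auto
  qed
  \<comment> \<open>Level \<open>s\<close> is \<open>K (Suc (t - s))\<close>, the second component
    of the induction statement.\<close>
  from this[of "t - s"] show ?thesis using assms(6) by (simp add: K_def)
qed

text \<open>The set \<open>D\<close> is left arbitrary so that it can come from the quotient in the
  general bound and be empty in an example where the twin cover alone is determining.\<close>

lemma gen_mycielskian_determining_set:
  assumes "pair_graph G" "no_isolated_vertices G" "t \<ge> 1"
    and "twin_cover G T" "T \<noteq> {}" "determining_set G (T \<union> D)"
  shows "determining_set (gen_mycielskian t G)
    ((\<lambda>(v, s). Copy v s) ` (T \<times> {..t}) \<union> (\<lambda>v. Copy v 0) ` D)" (is "determining_set ?M ?S")
proof -
  interpret pair_graph G by fact
  note arc = parcs_gen_mycielskian[OF assms(1)]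
  have V: "T \<subseteq> pverts G" "D \<subseteq> pverts G"
    using assms(6) by (auto simp: determining_set_def)
  have "f u = u" if f: "automorphism ?M f" "\<forall>u \<in> ?S. f u = u" and u: "u \<in> pverts ?M" for f u
  proof -
    have inj: "inj_on f (pverts ?M)"
      and pres: "\<And>x y. x \<in> pverts ?M \<Longrightarrow> y \<in> pverts ?M \<Longrightarrow>
        (f x, f y) \<in> parcs ?M \<longleftrightarrow> (x, y) \<in> parcs ?M"
      using f(1) by (auto simp: automorphism_def bij_betw_def)
    have fT: "f (Copy v s) = Copy v s" if "v \<in> T" "s \<le> t" for v s
      using f(2) that by auto
    obtain v where "v \<in> T" using assms(5) by blast
    then have apex: "f Apex = Apex"
      using V(1) fT by (intro automorphism_fixes_Apex[OF assms(1,3) _ f(1), of v]) auto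
    \<comment> \<open>The action of \<open>f\<close> on level \<open>s\<close>. The missing
      \<open>Apex\<close> branch is never reached for a vertex of \<open>G\<close> and
      \<open>s \<le> t\<close>, since \<open>f\<close> preserves levels.\<close>
    define g where "g s x = (case f (Copy x s) of Copy y _ \<Rightarrow> y)" for s x
    have lev: "f (Copy x s) = Copy (g s x) s" "g s x \<in> pverts G"
      if "x \<in> pverts G" "s \<le> t" for x s
    proof -
      have "f (Copy x s) \<in> (\<lambda>x. Copy x s) ` pverts G"
        using automorphism_preserves_level[OF assms(1-3) f(1) apex that(2)] that(1) by blast
      then show "f (Copy x s) = Copy (g s x) s" "g s x \<in> pverts G" by (auto simp: g_def)
    qed
    have ginj: "inj_on (g s) (pverts G)" if "s \<le> t" for s
    proof (rule inj_onI)
      fix x y assume "x \<in> pverts G" "y \<in> pverts G" "g s x = g s y"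
      then show "x = y"
        using lev[of x s] lev[of y s] that inj_onD[OF inj, of "Copy x s" "Copy y s"] by simp
    qed
    have gT: "g s v = v" if "v \<in> T" "s \<le> t" for v s
      using fT[OF that] by (simp add: g_def)
    \<comment> \<open>An injective self-map of a finite set is onto; as level 0 is a copy of
      \<open>G\<close>, the map \<open>g 0\<close> is an automorphism of \<open>G\<close>.\<close>
    have "g 0 ` pverts G = pverts G"
      using lev(2) ginj[of 0] pair_finite_verts by (intro endo_inj_surj) auto
    moreover have "(g 0 x, g 0 y) \<in> parcs G \<longleftrightarrow> (x, y) \<in> parcs G"
      if "x \<in> pverts G" "y \<in> pverts G" for x y
      using pres[of "Copy x 0" "Copy y 0"] that by (simp add: lev arc)
    ultimately have "automorphism G (g 0)"
      using ginj[of 0] by (simp add: automorphism_def bij_betw_def)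
    moreover have "g 0 v = v" if "v \<in> T \<union> D" for v
    proof -
      have "Copy v 0 \<in> ?S" using that by (auto intro!: image_eqI[of _ _ "(v, 0)"])
      then show ?thesis using f(2) by (simp add: g_def)
    qed
    ultimately have g0: "g 0 x = x" if "x \<in> pverts G" for x
      using assms(6) that unfolding determining_set_def by blast
    have gs: "s \<le> t \<longrightarrow> (\<forall>x \<in> pverts G. g s x = x)" for s
    proof (induction s)
      case 0
      then show ?case using g0 by simp
    next
      case (Suc s)
      show ?case
      proof (intro impI ballI)
        fix y assume s: "Suc s \<le> t" and y: "y \<in> pverts G"
        \<comment> \<open>By induction level \<open>s\<close> is fixed pointwise, so the arcs
          between levels \<open>s\<close> and \<open>Suc s\<close> show that \<open>y\<close> and
          its image have the same neighbours in \<open>G\<close>.\<close>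
        have "(x, g (Suc s) y) \<in> parcs G \<longleftrightarrow> (x, y) \<in> parcs G" if "x \<in> pverts G" for x
          using pres[of "Copy x s" "Copy y (Suc s)"] s y that Suc by (simp add: lev arc)
        then have "(x, g (Suc s) y) \<in> parcs G \<longleftrightarrow> (x, y) \<in> parcs G" for x
          using in_arcsD1 by blast
        then have nb: "open_nbhd G (g (Suc s) y) = open_nbhd G y"
          using arcs_symmetric by (auto simp: open_nbhd_def)
        show "g (Suc s) y = y"
          by (rule twin_cover_fixed[OF assms(4) ginj[OF s]]) (fact gT[OF _ s] y lev(2)[OF y s] nb)+
      qed
    qed
    show "f u = u"
      using u gs lev(1) apex by (cases u) auto
  qed
  moreover have "?S \<subseteq> pverts ?M" using V by auto
  ultimately show ?thesis unfolding determining_set_def by blast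
qed

lemma gen_mycielskian_determining_number_le:
  assumes "pair_graph G" "no_isolated_vertices G" "t \<ge> 1"
    and "twin_cover G T" "T \<noteq> {}" "determining_set G (T \<union> D)"
  shows "determining_number (gen_mycielskian t G) \<le> (t + 1) * card T + card D"
proof -
  have fin: "finite T" "finite D"
    using finite_determining_set[OF assms(1,6)] by auto
  have "determining_number (gen_mycielskian t G)
      \<le> card ((\<lambda>(v, s). Copy v s) ` (T \<times> {..t}) \<union> (\<lambda>v. Copy v 0) ` D)"
    by (intro determining_number_le gen_mycielskian_determining_set assms)
  also have "\<dots> \<le> card ((\<lambda>(v, s). Copy v s) ` (T \<times> {..t})) + card ((\<lambda>v. Copy v (0::nat)) ` D)"
    by (rule card_Un_le)
  also have "\<dots> \<le> card (T \<times> {..t}) + card D"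
    using fin by (intro add_mono card_image_le) auto
  also have "card (T \<times> {..t}) = (t + 1) * card T" by (simp add: card_cartesian_product)
  finally show ?thesis .
qed

lemma twin_cover_nonempty:
  assumes "pair_graph G" "\<not> equals_twin_quotient G" "twin_cover G T"
  shows "T \<noteq> {}"
  using assms(2,3) by (auto simp: equals_twin_quotient_iff[OF assms(1)] twin_cover_def)

theorem gen_mycielskian_determining_number_le_quotient:
  assumes "pair_graph G" "no_isolated_vertices G" "\<not> equals_twin_quotient G" "t \<ge> 1"
    and "twin_cover G T"
  shows "determining_number (gen_mycielskian t G)
    \<le> (t + 1) * card T + determining_number (twin_quotient G)"
proof -
  obtain D where D: "determining_set (twin_quotient G) D"
      "card D = determining_number (twin_quotient G)"
    by (rule determining_number_attained)
  obtain D' where D': "determining_set G (T \<union> D')" "card D' \<le> card D"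
    using determining_set_from_twin_quotient[OF assms(1,5) D(1)] by blast
  show ?thesis
    using gen_mycielskian_determining_number_le[OF assms(1,2,4,5) twin_cover_nonempty[OF assms(1,3,5)] D'(1)]
      D'(2) D(2) by simp
qed

section \<open>Sharpness\<close>

lemma minimum_twin_cover_singleton:
  assumes "x \<in> pverts G" "y \<in> pverts G" "x \<noteq> y" "open_nbhd G x = open_nbhd G y" "finite (pverts G)"
    and "\<And>a b. twins G a b \<Longrightarrow> a = x \<or> b = x"
  shows "minimum_twin_cover G {x}"
proof -
  have "twin_cover G {x}" using assms(1,6) by (auto simp: twin_cover_def)
  moreover have "card {x} \<le> card S" if S: "twin_cover G S" for S
  proof -
    have "twins G x y" using assms by (simp add: twins_def)
    then have "S \<noteq> {}" using S by (auto simp: twin_cover_def)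
    moreover have "finite S" using S assms(5) finite_subset by (auto simp: twin_cover_def)
    ultimately have "0 < card S" by (simp add: card_gt_0_iff)
    then show ?thesis by simp
  qed
  ultimately show ?thesis by (simp add: minimum_twin_cover_def is_arg_min_linorder)
qed

text \<open>The path 1 - 0 - 2 with centre 0. The leaves are its only twins, and fixing one of them
  fixes everything, so it attains the lower bound.\<close>

definition path3 :: "nat pair_pre_digraph" where
  "path3 = \<lparr> pverts = {0, 1, 2}, parcs = {(0, 1), (1, 0), (0, 2), (2, 0)} \<rparr>"

lemma path3_props:
  shows "pair_graph path3" "no_isolated_vertices path3" "\<not> equals_twin_quotient path3"
    and "minimum_twin_cover path3 {1}" "determining_set path3 {1}"
proof -
  show pg: "pair_graph path3"
    by unfold_locales (auto simp: path3_def symmetric_def sym_def)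
  show "no_isolated_vertices path3"
    by (auto simp: no_isolated_vertices_def open_nbhd_def path3_def)
  have nb: "open_nbhd path3 0 = {1, 2}" "open_nbhd path3 1 = {0}" "open_nbhd path3 2 = {0}"
    by (auto simp: open_nbhd_def path3_def)
  show "\<not> equals_twin_quotient path3"
    unfolding equals_twin_quotient_iff[OF pg] not_not
    by (intro exI[of _ 1] exI[of _ 2]) (use nb in \<open>simp add: twins_def path3_def\<close>)
  show "minimum_twin_cover path3 {1}"
    by (rule minimum_twin_cover_singleton[of _ _ 2])
      (use nb in \<open>auto simp: path3_def twins_def\<close>)
  have "f x = x" if f: "automorphism path3 f" "f 1 = 1" and "x \<in> pverts path3" for f x
  proof -
    have bij: "inj_on f {0, 1, 2}" "f ` {0, 1, 2} = {0, 1, 2}"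
      using f(1) by (auto simp: automorphism_def bij_betw_def path3_def)
    \<comment> \<open>The leaf 1 is fixed, hence so is its only neighbour 0; the vertex 2 is then
      all that remains.\<close>
    have "(f 1, f 0) \<in> parcs path3"
      using f(1) by (auto simp: automorphism_def path3_def)
    then have f0: "f 0 = 0" using f(2) by (simp add: path3_def)
    have "f 2 \<noteq> f 0" "f 2 \<noteq> f 1"
      using inj_onD[OF bij(1), of 2 0] inj_onD[OF bij(1), of 2 1] by auto
    moreover have "f 2 \<in> f ` {0, 1, 2}" by simp
    then have "f 2 \<in> {0, 1, 2}" unfolding bij(2) .
    ultimately have "f 2 = 2" using f0 f(2) by simp
    then show ?thesis using f0 f(2) that(3) by (auto simp: path3_def)
  qed
  then show "determining_set path3 {1}" by (auto simp: determining_set_def path3_def)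
qed

text \<open>
  The triangle 0, 1, 2 with two pendant vertices 3, 4 attached at 0: the vertices 1 and 2 can be
  exchanged, also in the quotient, but they are not twins since they are adjacent.
\<close>

definition tailed_triangle :: "nat pair_pre_digraph" where
  "tailed_triangle =
    \<lparr> pverts = {0, 1, 2, 3, 4},
      parcs = {(0, 1), (1, 0), (0, 2), (2, 0), (1, 2), (2, 1), (0, 3), (3, 0), (0, 4), (4, 0)} \<rparr>"

lemma tailed_triangle_nbhds:
  "open_nbhd tailed_triangle 0 = {1, 2, 3, 4}" "open_nbhd tailed_triangle 1 = {0, 2}"
  "open_nbhd tailed_triangle 2 = {0, 1}" "open_nbhd tailed_triangle 3 = {0}"
  "open_nbhd tailed_triangle 4 = {0}"
  by (auto simp: open_nbhd_def tailed_triangle_def)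

lemma twins_tailed_triangle: "twins tailed_triangle x y \<longleftrightarrow> (x, y) \<in> {(3, 4), (4, 3)}"
proof
  assume tw: "twins tailed_triangle x y"
  then have "x \<in> {0, 1, 2, 3, 4}" "y \<in> {0, 1, 2, 3, 4}"
    by (auto simp: twins_def tailed_triangle_def)
  then show "(x, y) \<in> {(3, 4), (4, 3)}"
    using tw by (auto simp: twins_def tailed_triangle_nbhds set_eq_subset simp del: One_nat_def)
next
  assume "(x, y) \<in> {(3, 4), (4, 3)}"
  then show "twins tailed_triangle x y"
    by (auto simp: twins_def tailed_triangle_nbhds) (auto simp: tailed_triangle_def)
qed

lemma tailed_triangle_props:
  shows "pair_graph tailed_triangle" "no_isolated_vertices tailed_triangle"
    and "\<not> equals_twin_quotient tailed_triangle" "minimum_twin_cover tailed_triangle {3}"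
proof -
  show pg: "pair_graph tailed_triangle"
    by unfold_locales (auto simp: tailed_triangle_def symmetric_def sym_def)
  show "no_isolated_vertices tailed_triangle"
    by (auto simp: no_isolated_vertices_def open_nbhd_def tailed_triangle_def)
  show "\<not> equals_twin_quotient tailed_triangle"
    by (auto simp: equals_twin_quotient_iff[OF pg] twins_tailed_triangle)
  show "minimum_twin_cover tailed_triangle {3}"
    by (rule minimum_twin_cover_singleton[of _ _ 4])
      (auto simp: twins_tailed_triangle tailed_triangle_nbhds, auto simp: tailed_triangle_def)
qed

text \<open>The quotient is a triangle with a single pendant vertex, the class
  \<open>{3, 4}\<close>. Fixing \<open>{1}\<close> suffices: the pendant class is the only other
  class not adjacent to \<open>{1}\<close>, its sole neighbour is \<open>{0}\<close>, and
  \<open>{2}\<close> is left over.\<close>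

lemma determining_number_tailed_triangle_quotient:
  "determining_number (twin_quotient tailed_triangle) \<le> 1"
proof -
  let ?Q = "twin_quotient tailed_triangle"
  let ?X = "{3, 4 :: nat}"
  have cls: "twin_rel tailed_triangle `` {0} = {0}" "twin_rel tailed_triangle `` {1} = {1}"
    "twin_rel tailed_triangle `` {2} = {2}" "twin_rel tailed_triangle `` {3} = ?X"
    "twin_rel tailed_triangle `` {4} = ?X"
    by (auto simp: twin_rel_def twins_tailed_triangle) (auto simp: tailed_triangle_def)
  have V: "pverts ?Q = {{0}, {1}, {2}, ?X}"
  proof -
    have "pverts ?Q = (\<lambda>x. twin_rel tailed_triangle `` {x}) ` pverts tailed_triangle"
      by (auto simp: twin_quotient_def quotient_def)
    also have "pverts tailed_triangle = {0, 1, 2, 3, 4}" by (simp add: tailed_triangle_def)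
    finally show ?thesis by (simp add: cls insert_commute del: One_nat_def)
  qed
  have E: "parcs ?Q = {({0}, {1}), ({1}, {0}), ({0}, {2}), ({2}, {0}), ({1}, {2}), ({2}, {1}),
      ({0}, ?X), (?X, {0})}"
  proof -
    have "parcs ?Q =
        (\<lambda>(x, z). (twin_rel tailed_triangle `` {x}, twin_rel tailed_triangle `` {z})) `
          parcs tailed_triangle"
      by (force simp: twin_quotient_def)
    also have "parcs tailed_triangle =
        {(0, 1), (1, 0), (0, 2), (2, 0), (1, 2), (2, 1), (0, 3), (3, 0), (0, 4), (4, 0)}"
      by (simp add: tailed_triangle_def)
    finally show ?thesis by (simp add: cls insert_commute del: One_nat_def)
  qed
  have "f C = C" if f: "automorphism ?Q f" "f {1} = {1}" and C: "C \<in> pverts ?Q" for f C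
  proof -
    have inj: "inj_on f (pverts ?Q)" and img: "\<And>c. c \<in> pverts ?Q \<Longrightarrow> f c \<in> pverts ?Q"
      and pres: "\<And>x y. x \<in> pverts ?Q \<Longrightarrow> y \<in> pverts ?Q \<Longrightarrow> (f x, f y) \<in> parcs ?Q \<longleftrightarrow> (x, y) \<in> parcs ?Q"
      using f(1) by (auto simp: automorphism_def bij_betw_def)
    have "f ?X \<noteq> f {1}" using inj_onD[OF inj, of ?X "{1}"] by (auto simp: V)
    moreover have "({1}, f ?X) \<notin> parcs ?Q"
      using pres[of "{1}" ?X] f(2) by (auto simp: V E)
    ultimately have X: "f ?X = ?X"
      using img[of ?X] f(2) by (auto simp: V E)
    have "(?X, f {0}) \<in> parcs ?Q" using pres[of ?X "{0}"] X by (auto simp: V E)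
    then have Z: "f {0} = {0}" by (auto simp: E)
    have "f {2} \<noteq> f {0}" "f {2} \<noteq> f {1}" "f {2} \<noteq> f ?X"
      using inj_onD[OF inj, of "{2}" "{0}"] inj_onD[OF inj, of "{2}" "{1}"]
        inj_onD[OF inj, of "{2}" ?X] by (auto simp: V)
    then have "f {2} = {2}" using img[of "{2}"] f(2) X Z by (auto simp: V)
    then show ?thesis using C X Z f(2) by (auto simp: V)
  qed
  then have "determining_set ?Q {{1}}" by (auto simp: determining_set_def V)
  from determining_number_le[OF this] show ?thesis by simp
qed

lemma tailed_triangle_determining_number_gt:
  "t + 1 < determining_number (gen_mycielskian t tailed_triangle)"
proof -
  \<comment> \<open>The exchange of the adjacent vertices 1 and 2 fixes the twins 3 and 4, as the
    strict lower bound requires.\<close>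
  define g where "g = id(1 := 2, 2 := (1::nat))"
  have "bij_betw g (pverts tailed_triangle) (pverts tailed_triangle)"
    by (rule bij_betw_byWitness[where f' = g]) (auto simp: g_def tailed_triangle_def)
  then have "automorphism tailed_triangle g"
    unfolding automorphism_def by (simp add: g_def tailed_triangle_def)
  then have "(t + 1) * card {3::nat} < determining_number (gen_mycielskian t tailed_triangle)"
    by (rule gen_mycielskian_determining_number_gt[OF tailed_triangle_props(1,4), of g 1])
      (auto simp: g_def twins_tailed_triangle, auto simp: tailed_triangle_def)
  then show ?thesis by simp
qed

theorem theorem7:
  shows
    "(\<forall>(G :: 'a pair_pre_digraph) T t.
        pair_graph G \<and> no_isolated_vertices G \<and> \<not> equals_twin_quotient G \<and>
        minimum_twin_cover G T \<and> t \<ge> 1 \<longrightarrow>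
          (t + 1) * card T \<le> determining_number (gen_mycielskian t G) \<and>
          determining_number (gen_mycielskian t G)
            \<le> (t + 1) * card T + determining_number (twin_quotient G))
    \<and> (\<forall>t \<ge> 1. \<exists>(G :: nat pair_pre_digraph) T.
        pair_graph G \<and> no_isolated_vertices G \<and> \<not> equals_twin_quotient G \<and>
        minimum_twin_cover G T \<and>
        determining_number (gen_mycielskian t G) = (t + 1) * card T)
    \<and> (\<forall>t \<ge> 1. \<exists>(G :: nat pair_pre_digraph) T.
        pair_graph G \<and> no_isolated_vertices G \<and> \<not> equals_twin_quotient G \<and>
        minimum_twin_cover G T \<and>
        determining_number (gen_mycielskian t G)
          = (t + 1) * card T + determining_number (twin_quotient G))"
proof (intro conjI allI impI; (elim conjE)?)
  fix G :: "'a pair_pre_digraph" and T and t :: nat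
  assume G: "pair_graph G" "no_isolated_vertices G" "\<not> equals_twin_quotient G" "1 \<le> t"
    and T: "minimum_twin_cover G T"
  show "(t + 1) * card T \<le> determining_number (gen_mycielskian t G)"
    by (rule gen_mycielskian_determining_number_ge[OF G(1) T])
  have "twin_cover G T" using T by (simp add: minimum_twin_cover_def is_arg_min_def)
  then show "determining_number (gen_mycielskian t G)
      \<le> (t + 1) * card T + determining_number (twin_quotient G)"
    by (rule gen_mycielskian_determining_number_le_quotient[OF G])
next
  fix t :: nat assume t: "1 \<le> t"
  have "twin_cover path3 {1}"
    using path3_props(4) by (simp add: minimum_twin_cover_def is_arg_min_def)
  \<comment> \<open>Here \<open>D\<close> is empty, because the twin cover \<open>{1}\<close> is
    already determining.\<close>
  then have "determining_number (gen_mycielskian t path3) \<le> (t + 1) * card {1::nat}"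
    using gen_mycielskian_determining_number_le[OF path3_props(1,2) t, of "{1}" "{}"] path3_props(5)
    by simp
  then have "determining_number (gen_mycielskian t path3) = (t + 1) * card {1::nat}"
    using gen_mycielskian_determining_number_ge[OF path3_props(1,4), of t] by linarith
  then show "\<exists>(G :: nat pair_pre_digraph) T.
        pair_graph G \<and> no_isolated_vertices G \<and> \<not> equals_twin_quotient G \<and>
        minimum_twin_cover G T \<and>
        determining_number (gen_mycielskian t G) = (t + 1) * card T"
    using path3_props by blast
next
  fix t :: nat assume t: "1 \<le> t"
  let ?G = tailed_triangle
  have "twin_cover ?G {3}"
    using tailed_triangle_props(4) by (simp add: minimum_twin_cover_def is_arg_min_def)
  \<comment> \<open>The determining number exceeds \<open>t + 1\<close> and is at most
    \<open>t + 1\<close> plus that of the quotient, which is at most 1; this squeeze forces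
    equality.\<close>
  from gen_mycielskian_determining_number_le_quotient[OF tailed_triangle_props(1-3) t this]
  have "determining_number (gen_mycielskian t ?G)
      = (t + 1) * card {3::nat} + determining_number (twin_quotient ?G)"
    using tailed_triangle_determining_number_gt[of t] determining_number_tailed_triangle_quotient
    by simp
  then show "\<exists>(G :: nat pair_pre_digraph) T.
        pair_graph G \<and> no_isolated_vertices G \<and> \<not> equals_twin_quotient G \<and>
        minimum_twin_cover G T \<and>
        determining_number (gen_mycielskian t G)
          = (t + 1) * card T + determining_number (twin_quotient G)"
    using tailed_triangle_props by blast
qed

end
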